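(* For any integers $m,n,r$ with $m\geq n\geq 0$, $$\sum_{k=0}^{m}\mathrm{per}\begin{pmatrix} M_{n,k}(y,y) & M_{n+r,k+1}(y,y)\\ M_{m,k}(y,y) & M_{m+r,k+1}(y,y)\end{pmatrix}=M_{m+n+r,1}(y,y)+H_{n,m}(r),$$ where $$H_{n,m}(r)=\begin{cases}\sum_{i=0}^{r-1}M_{n+i,0}(y,y)M_{m+r-i-1,0}(y,y), & \text{if } r\geq 1,\\ 0, & \text{if } r=0,\\ -\sum_{i=1}^{|r|}M_{n-i,0}(y,y)M_{m-|r|+i-1,0}(y,y), & \text{if } r\leq -1.\end{cases}$$
   Context: $\mathrm{per}$ denotes the permanent of a square matrix; for a $2\times 2$ matrix, $\mathrm{per}\begin{pmatrix}a&b\\c&d\end{pmatrix}=ad+bc$. A partial Motzkin path is a lattice path from $(0,0)$ to $(n,k)$ in the plane that does not go below the $X$-axis and consists of up steps $(1,1)$, down steps $(1,-1)$ and horizontal steps $(1,0)$. In a weighted partial Motzkin path, all up and down steps have weight $1$, horizontal steps lying on the $X$-axis have weight $x$, and horizontal steps not lying on the $X$-axis have weight $y$ (with $x,y$ indeterminates). The weight of a path is the product of the weights of its steps, and $M_{n,k}(x,y)$ is the sum of the weights of all weighted partial Motzkin paths from $(0,0)$ ending at $(n,k)$. Thus $M_{n,k}(y,y)$ is obtained by giving every horizontal step weight $y$. By convention $M_{n,k}(x,y)=0$ if $n<0$ or $k>n$ (there are no such paths). *)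

theory Defs
  imports "HOL-Analysis.Determinants"
begin

datatype motzkin_step = Up | Down | Level

fun rise :: "motzkin_step \<Rightarrow> int" where
  "rise Up = 1"
| "rise Down = -1"
| "rise Level = 0"

text \<open>A lattice path from the origin is given by its list of steps; every step advances the
  abscissa by one, so the path ends at the point with coordinates (length p, height p).\<close>

definition height :: "motzkin_step list \<Rightarrow> int" where
  "height p = (\<Sum>s\<leftarrow>p. rise s)"

definition partial_motzkin_paths :: "int \<Rightarrow> int \<Rightarrow> motzkin_step list set" where
  "partial_motzkin_paths n k =
     {p. int (length p) = n \<and> height p = k \<and> (\<forall>i\<le>length p. 0 \<le> height (take i p))}"

text \<open>The integer argument is the height at which the step starts.\<close>

fun step_weight :: "'a::comm_ring_1 \<Rightarrow> 'a \<Rightarrow> int \<Rightarrow> motzkin_step \<Rightarrow> 'a" where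
  "step_weight x y h Up = 1"
| "step_weight x y h Down = 1"
| "step_weight x y h Level = (if h = 0 then x else y)"

definition path_weight :: "'a::comm_ring_1 \<Rightarrow> 'a \<Rightarrow> motzkin_step list \<Rightarrow> 'a" where
  "path_weight x y p = (\<Prod>i<length p. step_weight x y (height (take i p)) (p ! i))"

text \<open>The weights range over an arbitrary commutative ring. Indeterminates are the special case
  where the ring is a polynomial ring over the integers, and the integer polynomial identities are
  exactly the identities that hold for all values in all commutative rings. The convention that
  \<open>M n k x y = 0\<close> for \<open>n < 0\<close> or \<open>k > n\<close> needs no extra clause: the set of paths is then empty.\<close>

definition M :: "int \<Rightarrow> int \<Rightarrow> 'a::comm_ring_1 \<Rightarrow> 'a \<Rightarrow> 'a" where
  "M n k x y = (\<Sum>p\<in>partial_motzkin_paths n k. path_weight x y p)"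

lemma finite_partial_motzkin_paths: "finite (partial_motzkin_paths n k)"
proof -
  have "UNIV = {Up, Down, Level}"
    using motzkin_step.exhaust by auto
  then have "finite (UNIV :: motzkin_step set)"
    by (metis finite.emptyI finite.insertI)
  then have "finite {p :: motzkin_step list. set p \<subseteq> UNIV \<and> length p = nat n}"
    by (rule finite_lists_length_eq)
  then show ?thesis
    by (rule rev_finite_subset) (auto simp: partial_motzkin_paths_def)
qed

lemma height_le_length: "height p \<le> int (length p)"
proof (induction p)
  case (Cons s p)
  then show ?case by (cases s) (auto simp: height_def)
qed (simp add: height_def)

lemma M_eq_0:
  assumes "n < 0 \<or> k > n"
  shows "M n k x y = 0"
proof -
  have "p \<notin> partial_motzkin_paths n k" for p
    using assms height_le_length[of p] by (auto simp: partial_motzkin_paths_def)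
  then have "partial_motzkin_paths n k = {}"
    by blast
  then show ?thesis
    by (simp add: M_def)
qed

definition permanent :: "'a::comm_ring_1 ^ 'n ^ 'n \<Rightarrow> 'a" where
  "permanent A = (\<Sum>p | p permutes UNIV. \<Prod>i\<in>UNIV. A $ i $ p i)"

lemma permanent_2: "permanent (A :: 'a::comm_ring_1 ^ 2 ^ 2) = A$1$1 * A$2$2 + A$1$2 * A$2$1"
proof -
  have "finite {2::2}" "1 \<notin> {2::2}"
    by auto
  then show ?thesis
    unfolding permanent_def UNIV_2
    by (subst sum_over_permutations_insert)
      (simp_all add: permutes_sing transpose_def)
qed

definition H :: "int \<Rightarrow> int \<Rightarrow> int \<Rightarrow> 'a::comm_ring_1 \<Rightarrow> 'a" where
  "H n m r y =
     (if r \<ge> 1 then \<Sum>i=0..r-1. M (n + i) 0 y y * M (m + r - i - 1) 0 y y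
      else if r = 0 then 0
      else - (\<Sum>i=1..\<bar>r\<bar>. M (n - i) 0 y y * M (m - \<bar>r\<bar> + i - 1) 0 y y))"

end

theory Submission
  imports Defs
begin

text \<open>
  Write \<open>f n k\<close> for \<^term>\<open>M n k y y\<close>, \<open>c j\<close> for \<open>f j 0\<close>, and put \<open>s = m + n + r\<close>. Expanding the
  permanents turns the left-hand side into \<open>A n (m + r) + A m (n + r)\<close>, where
  \<open>A a b = (\<Sum>k\<ge>0. f a k * f b (k + 1))\<close> is the sum \<open>adjacent_product\<close> below. Everything rests on
  the formula \<open>A a b = (\<Sum>0\<le>j<b. c j * c (a + b - 1 - j))\<close> for \<open>a \<ge> 0\<close>, which is
  \<open>adjacent_product_eq_prefix\<close>.

  Combinatorially, append to a path ending at height \<open>k\<close> the reversal of a path ending at height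
  \<open>k + 1\<close>, pushed down by one unit. The result is a path of length \<open>a + b\<close> from height \<open>0\<close> to height
  \<open>-1\<close> that stays at or above \<open>-1\<close> and first reaches \<open>-1\<close> after time \<open>a\<close>; cutting it at the step
  that first reaches \<open>-1\<close> gives the products \<open>c (a + b - 1 - j) * c j\<close>. Algebraically, the step
  recurrence of \<open>f\<close> is given by a symmetric tridiagonal operator, so moving one step from \<open>b\<close> to
  \<open>a\<close> changes \<open>A a b\<close> only by the boundary term \<open>c a * c (b - 1)\<close> coming from the
  shift by one between the two heights (\<open>adjacent_product_transfer\<close>).

  Both sums \<open>A n (m + r)\<close> and \<open>A m (n + r)\<close> have the same total length \<open>s\<close>, hence they are the
  prefix sums \<open>T (m + r)\<close> and \<open>T (n + r)\<close> of the one sequence \<open>g j = c j * c (s - 1 - j)\<close>. This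
  sequence lives on \<open>0 \<le> j < s\<close> and is a palindrome, so \<open>T (m + r) = T s - T n\<close>. As
  \<open>T s = A 0 s = f s 1\<close>, the left-hand side is \<open>f s 1 + (T (n + r) - T n)\<close>, and the difference
  of the two prefix sums is exactly \<^term>\<open>H n m r y\<close>, the three cases of which are the
  oriented sum of \<open>g\<close> from \<open>n\<close> to \<open>n + r\<close>.
\<close>


section \<open>The step recurrence for weighted Motzkin paths\<close>

lemma height_snoc: "height (p @ [s]) = height p + rise s"
  by (simp add: height_def)

lemma path_weight_snoc:
  "path_weight x y (p @ [s]) = path_weight x y p * step_weight x y (height p) s"
proof -
  have "(\<Prod>i<length p. step_weight x y (height (take i (p @ [s]))) ((p @ [s]) ! i))
      = (\<Prod>i<length p. step_weight x y (height (take i p)) (p ! i))"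
    by (rule prod.cong) (auto simp: nth_append)
  then show ?thesis
    by (simp add: path_weight_def)
qed

lemma partial_motzkin_paths_snoc_iff:
  "p @ [s] \<in> partial_motzkin_paths (n + 1) k
     \<longleftrightarrow> 0 \<le> k \<and> p \<in> partial_motzkin_paths n (k - rise s)"
proof -
  have "(\<forall>i\<le>length (p @ [s]). 0 \<le> height (take i (p @ [s])))
      \<longleftrightarrow> (\<forall>i\<le>length p. 0 \<le> height (take i p)) \<and> 0 \<le> height (p @ [s])"
    by (auto simp: le_Suc_eq)
  then show ?thesis
    by (auto simp: partial_motzkin_paths_def height_snoc)
qed

lemma height_of_motzkin_path:
  assumes "p \<in> partial_motzkin_paths n k"
  shows "height p = k" "0 \<le> k"
proof -
  show "height p = k"
    using assms by (simp add: partial_motzkin_paths_def)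
  have "\<forall>i\<le>length p. 0 \<le> height (take i p)"
    using assms by (simp add: partial_motzkin_paths_def)
  then have "0 \<le> height (take (length p) p)"
    by blast
  then show "0 \<le> k"
    using \<open>height p = k\<close> by simp
qed

lemma M_negative_height:
  assumes "k < 0"
  shows "M n k x y = 0"
proof -
  have "partial_motzkin_paths n k = {}"
    using assms height_of_motzkin_path(2) by fastforce
  then show ?thesis
    by (simp add: M_def)
qed

lemma M_0_0: "M 0 0 x y = 1"
proof -
  have "partial_motzkin_paths 0 0 = {[]}"
    by (auto simp: partial_motzkin_paths_def height_def)
  then show ?thesis
    by (simp add: M_def path_weight_def)
qed

text \<open>Sorting the paths by their last step.\<close>

lemma M_step:
  assumes "n \<ge> 0" and "k \<ge> 0"
  shows "M (n + 1) k x y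
           = M n (k - 1) x y + (if k = 0 then x else y) * M n k x y + M n (k + 1) x y"
proof -
  let ?P = partial_motzkin_paths
  let ?Q = "\<lambda>s. (\<lambda>p. p @ [s]) ` ?P n (k - rise s)"
  have split: "?P (n + 1) k = ?Q Up \<union> ?Q Level \<union> ?Q Down"
  proof (rule set_eqI)
    fix q
    show "q \<in> ?P (n + 1) k \<longleftrightarrow> q \<in> ?Q Up \<union> ?Q Level \<union> ?Q Down"
    proof (cases q rule: rev_cases)
      case Nil
      then show ?thesis
        using assms by (auto simp: partial_motzkin_paths_def)
    next
      case (snoc p s)
      have "q \<in> ?P (n + 1) k \<longleftrightarrow> p \<in> ?P n (k - rise s)"
        unfolding snoc partial_motzkin_paths_snoc_iff using assms by simp
      then show ?thesis
        unfolding snoc by (cases s) auto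
    qed
  qed
  have disj: "?Q Up \<inter> ?Q Level = {}" "(?Q Up \<union> ?Q Level) \<inter> ?Q Down = {}"
    by auto
  have fin: "finite (?Q s)" for s
    by (simp add: finite_partial_motzkin_paths)
  have part: "(\<Sum>q\<in>?Q s. path_weight x y q)
      = M n (k - rise s) x y * step_weight x y (k - rise s) s" for s
  proof -
    have "(\<Sum>q\<in>?Q s. path_weight x y q)
        = (\<Sum>p\<in>?P n (k - rise s). path_weight x y (p @ [s]))"
      by (subst sum.reindex) (auto simp: inj_on_def)
    also have "\<dots> = (\<Sum>p\<in>?P n (k - rise s). path_weight x y p * step_weight x y (k - rise s) s)"
      by (rule sum.cong) (auto simp: path_weight_snoc height_of_motzkin_path(1))
    finally show ?thesis
      by (simp add: M_def sum_distrib_right)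
  qed
  have "M (n + 1) k x y = (\<Sum>q\<in>(?Q Up \<union> ?Q Level) \<union> ?Q Down. path_weight x y q)"
    unfolding M_def split ..
  also have "\<dots> = (\<Sum>q\<in>?Q Up \<union> ?Q Level. path_weight x y q) + (\<Sum>q\<in>?Q Down. path_weight x y q)"
    by (rule sum.union_disjoint[OF finite_UnI[OF fin fin] fin disj(2)])
  also have "(\<Sum>q\<in>?Q Up \<union> ?Q Level. path_weight x y q)
      = (\<Sum>q\<in>?Q Up. path_weight x y q) + (\<Sum>q\<in>?Q Level. path_weight x y q)"
    by (rule sum.union_disjoint[OF fin fin disj(1)])
  finally show ?thesis
    by (simp only: part) (simp add: mult.commute)
qed


section \<open>Pairing paths that end at adjacent heights\<close>

text \<open>Heights above \<open>a\<close> contribute nothing, so the summation range stands for all \<open>k \<ge> 0\<close>.\<close>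

definition adjacent_product :: "int \<Rightarrow> int \<Rightarrow> 'a::comm_ring_1 \<Rightarrow> 'a" where
  "adjacent_product a b y = (\<Sum>k=0..a. M a k y y * M b (k + 1) y y)"

lemma adjacent_product_extend:
  assumes "N \<ge> a"
  shows "(\<Sum>k=0..N. M a k y y * M b (k + 1) y y) = adjacent_product a b y"
  unfolding adjacent_product_def
  by (rule sum.mono_neutral_right) (use assms in \<open>auto simp: M_eq_0\<close>)

lemma adjacent_product_nonpos:
  assumes "b \<le> 0"
  shows "adjacent_product a b y = 0"
  unfolding adjacent_product_def
  by (rule sum.neutral) (use assms in \<open>auto simp: M_eq_0\<close>)

lemma adjacent_product_0: "adjacent_product 0 b y = M b 1 y y"
  by (simp add: adjacent_product_def M_0_0)

lemma sum_telescope_int: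
  fixes F :: "int \<Rightarrow> 'a::ab_group_add"
  assumes "N \<ge> -1"
  shows "(\<Sum>k=0..N. F k - F (k + 1)) = F 0 - F (N + 1)"
  using assms
proof (induction N rule: int_ge_induct)
  case base
  then show ?case by simp
next
  case (step N)
  then have "{0..N + 1} = insert (N + 1) {0..N}"
    by auto
  then show ?case
    using step by simp
qed

text \<open>In \<open>A a (b + 1) - A (a + 1) b\<close> the Level steps cancel, and what remains of the Up and Down
  steps telescopes over the height; only the boundary term at height \<open>0\<close> survives.\<close>

lemma adjacent_product_transfer:
  assumes "a \<ge> 0" and "b \<ge> 0"
  shows "adjacent_product a (b + 1) y = adjacent_product (a + 1) b y + M a 0 y y * M b 0 y y"
proof -
  \<comment> \<open>A discrete antiderivative of the difference of summands; both of its products vanish at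
    height \<open>a + 2\<close>, which is why the sums run up to \<open>a + 1\<close>.\<close>
  define F where "F k = M a k y y * M b k y y - M a (k - 1) y y * M b (k + 1) y y" for k
  have summand: "M a k y y * M (b + 1) (k + 1) y y - M (a + 1) k y y * M b (k + 1) y y
      = F k - F (k + 1)" if "k \<ge> 0" for k
  proof -
    have a: "M (a + 1) k y y = M a (k - 1) y y + y * M a k y y + M a (k + 1) y y"
      using M_step[of a k y y] assms that by (simp split: if_splits)
    have b: "M (b + 1) (k + 1) y y = M b k y y + y * M b (k + 1) y y + M b (k + 2) y y"
      using M_step[of b "k + 1" y y] assms that by (simp add: add.assoc)
    show ?thesis
      unfolding a b F_def by (simp add: algebra_simps)
  qed
  have "adjacent_product a (b + 1) y - adjacent_product (a + 1) b y
      = (\<Sum>k=0..a+1. M a k y y * M (b + 1) (k + 1) y y - M (a + 1) k y y * M b (k + 1) y y)"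
    by (simp add: sum_subtractf adjacent_product_extend)
  also have "\<dots> = (\<Sum>k=0..a+1. F k - F (k + 1))"
    by (rule sum.cong) (auto simp: summand)
  also have "\<dots> = F 0 - F (a + 1 + 1)"
    using assms by (intro sum_telescope_int) simp
  also have "\<dots> = M a 0 y y * M b 0 y y"
    by (simp add: F_def M_eq_0 M_negative_height)
  finally show ?thesis
    by (simp add: algebra_simps)
qed


section \<open>Prefix sums of a palindromic convolution\<close>

definition convolution_prefix :: "int \<Rightarrow> int \<Rightarrow> 'a::comm_ring_1 \<Rightarrow> 'a" where
  "convolution_prefix s b y = (\<Sum>j=0..<b. M j 0 y y * M (s - 1 - j) 0 y y)"

text \<open>Steps are moved from \<open>b\<close> to \<open>a\<close>, with \<open>a + b\<close> fixed, until \<open>b = 0\<close>, where the sum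
  \<^const>\<open>adjacent_product\<close> vanishes.\<close>

lemma adjacent_product_eq_prefix:
  assumes "a \<ge> 0"
  shows "adjacent_product a b y = convolution_prefix (a + b) b y"
proof (cases "b \<ge> 0")
  case True
  then show ?thesis
    using assms
  proof (induction b arbitrary: a rule: int_ge_induct)
    case base
    then show ?case
      by (simp add: adjacent_product_nonpos convolution_prefix_def)
  next
    case (step b)
    have "{0..<b + 1} = insert b {0..<b}"
      using step by auto
    moreover have "adjacent_product (a + 1) b y = convolution_prefix (a + 1 + b) b y"
      using step by simp
    ultimately show ?case
      using step adjacent_product_transfer[of a b y]
      by (simp add: convolution_prefix_def algebra_simps)
  qed
next
  case False
  then show ?thesis
    by (simp add: adjacent_product_nonpos convolution_prefix_def)
qed

text \<open>The summand is supported on \<open>0 \<le> j < s\<close>; restricting to this range makes the complement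
  and reflection arguments below valid for prefixes of any, even negative, length.\<close>

lemma convolution_prefix_supported:
  "convolution_prefix s b y = (\<Sum>j\<in>{0..<s} \<inter> {..<b}. M j 0 y y * M (s - 1 - j) 0 y y)"
proof -
  have "M j 0 y y * M (s - 1 - j) 0 y y = 0" if "j \<ge> s" for j
    using that by (simp add: M_eq_0)
  then show ?thesis
    unfolding convolution_prefix_def by (intro sum.mono_neutral_right) force+
qed

lemma convolution_prefix_complement:
  "convolution_prefix s b y + convolution_prefix s (s - b) y = convolution_prefix s s y"
proof -
  let ?g = "\<lambda>j. M j 0 y y * M (s - 1 - j) 0 y y"
  have "convolution_prefix s (s - b) y = (\<Sum>j\<in>{0..<s} \<inter> {b..}. ?g j)"
    unfolding convolution_prefix_supported
    by (rule sum.reindex_bij_witness[of _ "\<lambda>j. s - 1 - j" "\<lambda>j. s - 1 - j"])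
      (auto simp: mult.commute)
  then have "convolution_prefix s b y + convolution_prefix s (s - b) y
      = (\<Sum>j\<in>({0..<s} \<inter> {..<b}) \<union> ({0..<s} \<inter> {b..}). ?g j)"
    by (subst sum.union_disjoint) (auto simp: convolution_prefix_supported)
  also have "({0..<s} \<inter> {..<b}) \<union> ({0..<s} \<inter> {b..}) = {0..<s}"
    by auto
  finally show ?thesis
    by (simp add: convolution_prefix_def)
qed

text \<open>Prefixes may also be extended to negative indices without changing their value, which makes
  their differences sums over intervals.\<close>

lemma convolution_prefix_diff:
  assumes "a \<le> b" and "0 \<le> b"
  shows "convolution_prefix s b y - convolution_prefix s a y
           = (\<Sum>j=a..<b. M j 0 y y * M (s - 1 - j) 0 y y)"
proof -
  let ?g = "\<lambda>j. M j 0 y y * M (s - 1 - j) 0 y y"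
  define l where "l = min 0 a"
  have ext: "convolution_prefix s c y = (\<Sum>j=l..<c. ?g j)" for c
    unfolding convolution_prefix_def
    by (rule sum.mono_neutral_left) (auto simp: l_def M_eq_0)
  have "{l..<b} = {l..<a} \<union> {a..<b}"
    using assms by (auto simp: l_def)
  then have "(\<Sum>j=l..<b. ?g j) = (\<Sum>j=l..<a. ?g j) + (\<Sum>j=a..<b. ?g j)"
    by (metis (no_types, lifting) finite_atLeastLessThan_int ivl_disj_int_two(3) sum.union_disjoint)
  then show ?thesis
    by (simp add: ext)
qed

lemma H_eq_prefix_diff:
  assumes "n \<ge> 0"
  shows "H n m r y = convolution_prefix (m + n + r) (n + r) y - convolution_prefix (m + n + r) n y"
proof -
  let ?g = "\<lambda>j. M j 0 y y * M (m + n + r - 1 - j) 0 y y"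
  consider "r \<ge> 1" | "r = 0" | "r \<le> -1"
    by linarith
  then show ?thesis
  proof cases
    case 1
    have "H n m r y = (\<Sum>i=0..r-1. M (n + i) 0 y y * M (m + r - i - 1) 0 y y)"
      using 1 by (simp add: H_def)
    also have "\<dots> = (\<Sum>j=n..<n+r. ?g j)"
      by (rule sum.reindex_bij_witness[of _ "\<lambda>j. j - n" "\<lambda>i. n + i"])
        (auto simp: algebra_simps)
    finally show ?thesis
      using 1 assms by (simp add: convolution_prefix_diff)
  next
    case 2
    then show ?thesis
      by (simp add: H_def)
  next
    case 3
    have "H n m r y = - (\<Sum>i=1..\<bar>r\<bar>. M (n - i) 0 y y * M (m - \<bar>r\<bar> + i - 1) 0 y y)"
      using 3 by (simp add: H_def)
    also have "(\<Sum>i=1..\<bar>r\<bar>. M (n - i) 0 y y * M (m - \<bar>r\<bar> + i - 1) 0 y y) = (\<Sum>j=n+r..<n. ?g j)"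
      using 3 by (intro sum.reindex_bij_witness[of _ "\<lambda>j. n - j" "\<lambda>i. n - i"])
        (auto simp: algebra_simps)
    also have "\<dots> = convolution_prefix (m + n + r) n y - convolution_prefix (m + n + r) (n + r) y"
      using 3 assms by (subst convolution_prefix_diff) auto
    finally show ?thesis
      by simp
  qed
qed


section \<open>The permanent identity\<close>

theorem theorem4p1:
  fixes m n r :: int and y :: "'a::comm_ring_1"
  assumes "m \<ge> n" and "n \<ge> 0"
  shows "(\<Sum>k=0..m. permanent (vector [vector [M n k y y, M (n + r) (k + 1) y y],
                                       vector [M m k y y, M (m + r) (k + 1) y y]] :: 'a ^ 2 ^ 2))
         = M (m + n + r) 1 y y + H n m r y"
proof -
  let ?T = "\<lambda>b. convolution_prefix (m + n + r) b y"
  have "(\<Sum>k=0..m. permanent (vector [vector [M n k y y, M (n + r) (k + 1) y y],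
                                       vector [M m k y y, M (m + r) (k + 1) y y]] :: 'a ^ 2 ^ 2))
      = (\<Sum>k=0..m. M n k y y * M (m + r) (k + 1) y y)
        + (\<Sum>k=0..m. M m k y y * M (n + r) (k + 1) y y)"
    by (simp add: permanent_2 sum.distrib mult.commute)
  also have "\<dots> = adjacent_product n (m + r) y + adjacent_product m (n + r) y"
    using assms by (simp add: adjacent_product_extend)
  also have "\<dots> = ?T (m + r) + ?T (n + r)"
    using assms by (simp add: adjacent_product_eq_prefix algebra_simps)
  also have "?T (m + r) = ?T (m + n + r) - ?T n"
    using convolution_prefix_complement[of "m + n + r" n y] by (simp add: algebra_simps)
  also have "?T (m + n + r) = M (m + n + r) 1 y y"
    using adjacent_product_eq_prefix[of 0 "m + n + r" y] by (simp add: adjacent_product_0)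
  finally show ?thesis
    using assms by (simp add: H_eq_prefix_diff)
qed

end
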